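(* For every integer $n\geq 0$, $$B_{n}(y,t)=\sum_{k=0}^{n}\binom{n}{k}(1+y)^{k}(1-t)^{n-k}A_{k}(t).$$
   Context: $\mathfrak{S}_n$ is the set of permutations $\pi=\pi_1\cdots\pi_n$ of $[n]=\{1,\dots,n\}$, $\mathrm{des}(\pi)$ is the number of $i\in[n-1]$ with $\pi_i>\pi_{i+1}$, and the Eulerian polynomials are $A_n(t)=\sum_{\pi\in\mathfrak{S}_n}t^{\mathrm{des}(\pi)+1}$ for $n\ge1$ and $A_0(t)=1$. $\mathfrak{B}_n$ is the set of signed permutations: permutations $\pi$ of $\{-n,\dots,-1,0,1,\dots,n\}$ with $\pi_{-i}=-\pi_i$ for all $i$ (so $\pi_0=0$), written $\pi=\pi_1\cdots\pi_n$. For $\pi\in\mathfrak{B}_n$, $\mathrm{des}_B(\pi)$ is the number of $i\in\{0,1,\dots,n-1\}$ with $\pi_i>\pi_{i+1}$ (where $\pi_0=0$), and $\mathrm{neg}(\pi)$ is the number of $i\in[n]$ with $\pi_i<0$. $B_n(y,t)=\sum_{\pi\in\mathfrak{B}_n}y^{\mathrm{neg}(\pi)}t^{\mathrm{des}_B(\pi)}$ for $n\ge1$, and $B_0(y,t)=1$. *)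

theory Defs
  imports Complex_Main "HOL-Combinatorics.Permutations"
begin

definition sym_perms :: "nat \<Rightarrow> (nat \<Rightarrow> nat) set" where
  "sym_perms n = {p. p permutes {1..n}}"

definition des :: "nat \<Rightarrow> (nat \<Rightarrow> nat) \<Rightarrow> nat" where
  "des n p = card {i \<in> {1..<n}. p i > p (i + 1)}"

(* A polynomial in Z[t] (resp. Z[y,t]) is rendered by its value at an arbitrary element
   (resp. pair of elements) of an arbitrary commutative ring. The polynomial rings are
   themselves instances, with t and y taken to be the indeterminates, so identities between
   these values are the same as identities between polynomials.

   The case n = 0 is separate because the sum formula would give t instead of 1. *)
definition eulerian_poly :: "nat \<Rightarrow> 'a::comm_ring_1 \<Rightarrow> 'a" where
  "eulerian_poly n t = (if n = 0 then 1 else (\<Sum>p\<in>sym_perms n. t ^ (des n p + 1)))"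

(* The oddness condition at i = 0 forces p 0 = 0. *)
definition signed_perms :: "nat \<Rightarrow> (int \<Rightarrow> int) set" where
  "signed_perms n =
     {p. p permutes {- int n..int n} \<and> (\<forall>i\<in>{- int n..int n}. p (- i) = - p i)}"

definition des_B :: "nat \<Rightarrow> (int \<Rightarrow> int) \<Rightarrow> nat" where
  "des_B n p = card {i \<in> {0..<int n}. p i > p (i + 1)}"

definition neg :: "nat \<Rightarrow> (int \<Rightarrow> int) \<Rightarrow> nat" where
  "neg n p = card {i \<in> {1..int n}. p i < 0}"

definition eulerian_poly_B :: "nat \<Rightarrow> 'a::comm_ring_1 \<Rightarrow> 'a \<Rightarrow> 'a" where
  "eulerian_poly_B n y t =
     (if n = 0 then 1 else (\<Sum>p\<in>signed_perms n. y ^ neg n p * t ^ des_B n p))"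

end

theory Submission
  imports Defs "HOL-Combinatorics.Multiset_Permutations"
begin

text \<open>Read a signed permutation as a word and give each position \<open>i \<ge> 0\<close> the weight \<open>t\<close> at a
  descent and \<open>1 = t + (1 - t)\<close> at an ascent. Let \<open>j\<close> be the first position at which \<open>t\<close> is
  chosen. The letters before it form an increasing positive prefix, so they amount to a set \<open>U\<close>
  of \<open>j\<close> letters, all positive, of weight \<open>(1 - t)^j\<close>. The remaining word is an
  arbitrary arrangement of the other letters in which the initial position has weight \<open>t\<close>;
  for each choice of signs it contributes \<open>A\<^sub>n\<^sub>-\<^sub>j(t)\<close>, since only the relative order
  matters, and the choices of signs give \<open>(1 + y)^(n - j)\<close>.\<close>

section \<open>Words, their descents and their weights\<close>

fun word_des :: "'b::linorder list \<Rightarrow> nat" where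
  "word_des [] = 0"
| "word_des [x] = 0"
| "word_des (x # y # xs) = (if x > y then 1 else 0) + word_des (y # xs)"

text \<open>A nonempty word has a descent at its initial position, as if preceded by infinity; this
  is the shift in the exponent \<open>des + 1\<close> of the Eulerian polynomials.\<close>

definition word_weight :: "'a::comm_ring_1 \<Rightarrow> 'b::linorder list \<Rightarrow> 'a" where
  "word_weight t xs = (if xs = [] then 1 else t ^ (word_des xs + 1))"

lemma word_des_eq_card:
  "word_des xs = card {i. Suc i < length xs \<and> xs ! i > xs ! Suc i}"
proof (induction xs rule: word_des.induct)
  case (3 x y xs)
  let ?S = "{i. Suc i < length (y # xs) \<and> (y # xs) ! i > (y # xs) ! Suc i}"
  have fin: "finite ?S"
    by (rule finite_subset[of _ "{..<length (y # xs)}"]) auto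
  have "{i. Suc i < length (x # y # xs) \<and> (x # y # xs) ! i > (x # y # xs) ! Suc i}
      = (if x > y then {0} else {}) \<union> Suc ` ?S"
    (is "?L = ?R")
  proof (rule set_eqI)
    fix i show "i \<in> ?L \<longleftrightarrow> i \<in> ?R"
      by (cases i) auto
  qed
  moreover have "card ((if x > y then {0} else {}) \<union> Suc ` ?S)
      = (if x > y then 1 else 0) + card ?S"
    using fin by (subst card_Un_disjoint) (auto simp: card_image)
  ultimately show ?case
    using 3 by simp
qed auto

text \<open>Bridge from words to descents counted by index: \<open>m = 1\<close> serves
  \<open>des\<close>, and \<open>m = 0\<close> serves \<open>des_B\<close>, where the value at 0
  starts the word.\<close>

lemma word_des_map_upt:
  "word_des (map f [m..<k]) = card {i \<in> {m..<k - 1}. f i > f (Suc i)}"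
proof -
  have "{i \<in> {m..<k - 1}. f i > f (Suc i)}
      = (\<lambda>i. i + m) ` {i. Suc i < k - m \<and> f (m + i) > f (Suc (m + i))}"
    (is "?L = ?R")
  proof (rule set_eqI)
    fix i show "i \<in> ?L \<longleftrightarrow> i \<in> ?R"
      by (auto simp: image_iff add.commute intro!: exI[of _ "i - m"])
  qed
  then have "card ?L = card {i. Suc i < k - m \<and> f (m + i) > f (Suc (m + i))}"
    by (simp add: card_image)
  also have "{i. Suc i < k - m \<and> f (m + i) > f (Suc (m + i))}
      = {i. Suc i < length (map f [m..<k])
          \<and> map f [m..<k] ! i > map f [m..<k] ! Suc i}"
    by (intro Collect_cong) auto
  finally show ?thesis
    by (simp only: word_des_eq_card)
qed

lemma word_des_map_strict_mono:
  assumes "strict_mono_on (set xs) f"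
  shows "word_des (map f xs) = word_des xs"
  using assms
proof (induction xs rule: word_des.induct)
  case (3 x y xs)
  have "f x > f y \<longleftrightarrow> x > y"
    by (rule strict_mono_on_less[OF "3.prems"]) auto
  moreover have "strict_mono_on (set (y # xs)) f"
    using "3.prems" by (rule monotone_on_subset) auto
  ultimately show ?case
    using "3.IH" by simp
qed auto

text \<open>Relabelling letters along the increasing enumeration of \<open>V\<close> maps the
  arrangements of \<open>{1..card V}\<close> bijectively to those of \<open>V\<close> and keeps all
  descents. The letter type is general because the words to be standardized may contain negative
  integers.\<close>

lemma sum_word_weight_permutations:
  fixes V :: "'b::linorder set"
  assumes "finite V"
  shows "(\<Sum>xs\<in>permutations_of_set V. word_weight t xs)
    = (\<Sum>xs\<in>permutations_of_set {1..card V}. word_weight t xs)"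
proof -
  \<comment> \<open>The \<open>i\<close>-th smallest element of \<open>V\<close>; the shift is there
    because lists are indexed from 0.\<close>
  define f where "f i = sorted_list_of_set V ! (i - 1)" for i
  have len: "length (sorted_list_of_set V) = card V"
    by simp
  have mono: "strict_mono_on {1..card V} f"
  proof (rule strict_mono_onI)
    fix i j assume "i \<in> {1..card V}" "j \<in> {1..card V}" "i < j"
    then show "f i < f j"
      unfolding f_def
      by (intro sorted_wrt_nth_less[OF strict_sorted_list_of_set]) auto
  qed
  then have inj: "inj_on f {1..card V}"
    by (rule strict_mono_on_imp_inj_on)
  have "f ` {1..card V} \<subseteq> set (sorted_list_of_set V)"
    using len unfolding f_def by (auto simp del: set_sorted_list_of_set)
  then have img: "f ` {1..card V} = V"
    using inj assms by (intro card_subset_eq) (simp_all add: card_image)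
  have inj_map: "inj_on (map f) (permutations_of_set {1..card V})"
    using inj by (intro inj_on_mapI) (auto elim!: inj_on_subset simp: permutations_of_setD)
  have "(\<Sum>xs\<in>permutations_of_set V. word_weight t xs)
      = (\<Sum>xs\<in>map f ` permutations_of_set {1..card V}. word_weight t xs)"
    using permutations_of_set_image_inj[OF inj] img by simp
  also have "\<dots>
      = (\<Sum>xs\<in>permutations_of_set {1..card V}. word_weight t (map f xs))"
    using inj_map by (simp add: sum.reindex)
  also have "\<dots> = (\<Sum>xs\<in>permutations_of_set {1..card V}. word_weight t xs)"
    using mono by (intro sum.cong refl)
      (auto simp: word_weight_def word_des_map_strict_mono permutations_of_setD)
  finally show ?thesis .
qed

section \<open>Eulerian polynomials as sums over words\<close>

lemma map_bij_permutes:
  "bij_betw (\<lambda>p. map p [1..<Suc n]) (sym_perms n) (permutations_of_set {1..n})"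
proof (rule bij_betw_imageI)
  show "inj_on (\<lambda>p. map p [1..<Suc n]) (sym_perms n)"
  proof (rule inj_onI, rule ext)
    fix p q i
    assume "p \<in> sym_perms n" "q \<in> sym_perms n" "map p [1..<Suc n] = map q [1..<Suc n]"
    then show "p i = q i"
      by (cases "i \<in> {1..n}")
         (auto simp: sym_perms_def permutes_not_in simp del: upt_Suc)
  qed
  show "(\<lambda>p. map p [1..<Suc n]) ` sym_perms n = permutations_of_set {1..n}"
  proof (intro equalityI subsetI)
    fix xs assume "xs \<in> (\<lambda>p. map p [1..<Suc n]) ` sym_perms n"
    then obtain p where p: "p permutes {1..n}" and xs: "xs = map p [1..<Suc n]"
      by (auto simp: sym_perms_def)
    have "set [1..<Suc n] = {1..n}"
      by auto
    then show "xs \<in> permutations_of_set {1..n}"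
      using p unfolding xs permutations_of_set_def
      by (simp add: distinct_map permutes_image permutes_inj_on del: upt_Suc)
  next
    fix xs assume xs: "xs \<in> permutations_of_set {1..n}"
    then have set: "set xs = {1..n}" and dist: "distinct xs"
      by (auto simp: permutations_of_setD)
    then have len: "length xs = n"
      using distinct_card by fastforce
    \<comment> \<open>The word supplies the values on \<open>{1..n}\<close>; the identity elsewhere
      is what \<open>permutes\<close> demands.\<close>
    define p where "p i = (if i \<in> {1..n} then xs ! (i - 1) else i)" for i
    have "inj_on p {1..n}"
      using dist len by (auto simp: inj_on_def p_def nth_eq_iff_index_eq)
    moreover have sub: "p ` {1..n} \<subseteq> {1..n}"
    proof
      fix v assume "v \<in> p ` {1..n}"
      then obtain i where "i \<in> {1..n}" "v = xs ! (i - 1)"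
        by (auto simp: p_def)
      then have "v \<in> set xs"
        using len by auto
      then show "v \<in> {1..n}"
        by (simp only: set)
    qed
    ultimately have "bij_betw p {1..n} {1..n}"
      by (simp add: bij_betw_def endo_inj_surj)
    then have "p permutes {1..n}"
      by (rule bij_imp_permutes) (simp only: p_def if_False)
    moreover have "map p [1..<Suc n] = xs"
      using len by (intro nth_equalityI) (auto simp: p_def simp del: upt_Suc)
    ultimately show "xs \<in> (\<lambda>p. map p [1..<Suc n]) ` sym_perms n"
      by (auto simp: sym_perms_def simp del: upt_Suc)
  qed
qed

lemma eulerian_poly_eq_sum_words:
  "eulerian_poly n t = (\<Sum>xs\<in>permutations_of_set {1..n}. word_weight t xs)"
proof (cases "n = 0")
  \<comment> \<open>The weight 1 of the empty word matches the separate value of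
    \<open>eulerian_poly\<close> at 0.\<close>
  case True
  then show ?thesis
    by (simp add: eulerian_poly_def word_weight_def)
next
  case False
  then have "eulerian_poly n t = (\<Sum>p\<in>sym_perms n. word_weight t (map p [1..<Suc n]))"
    unfolding eulerian_poly_def
    by (auto simp: word_weight_def word_des_map_upt des_def simp del: upt_Suc)
  also have "\<dots> = (\<Sum>xs\<in>permutations_of_set {1..n}. word_weight t xs)"
    by (rule sum.reindex_bij_betw[OF map_bij_permutes])
  finally show ?thesis .
qed

section \<open>Expansion along increasing prefixes\<close>

text \<open>The index \<open>j\<close> counts the comparisons settled by \<open>1 - t\<close> before
  \<open>t\<close> is first taken. After that nothing is expanded, so the rest keeps its descent
  weight together with the extra \<open>t\<close> in \<open>word_weight\<close>. For
  \<open>j = length xs\<close> the factor \<open>t\<close> is never taken, and the empty rest has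
  weight 1.\<close>

lemma power_word_des_expand:
  "t ^ word_des (a # xs)
    = (\<Sum>j\<le>length xs. if sorted (a # take j xs)
        then (1 - t) ^ j * word_weight t (drop j xs) else 0)"
proof (induction xs arbitrary: a)
  case Nil
  then show ?case by (simp add: word_weight_def)
next
  case (Cons b xs)
  \<comment> \<open>The summand \<open>j = 0\<close> takes \<open>t\<close> at the first comparison.
    The others need \<open>a \<le> b\<close> and, up to one factor \<open>1 - t\<close>, form the
    expansion of the word starting at \<open>b\<close>.\<close>
  have "(\<Sum>j\<le>length (b # xs). if sorted (a # take j (b # xs))
          then (1 - t) ^ j * word_weight t (drop j (b # xs)) else 0)
      = word_weight t (b # xs)
        + (\<Sum>j\<le>length xs. if a \<le> b \<and> sorted (b # take j xs)
            then (1 - t) ^ Suc j * word_weight t (drop j xs) else 0)"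
    unfolding list.size(4) add_Suc_right add_0_right sum.atMost_Suc_shift
    by (intro arg_cong2[where f = "(+)"] sum.cong)
       (auto simp: sorted2 sorted1 simp del: sorted_wrt.simps(2))
  also have "(\<Sum>j\<le>length xs. if a \<le> b \<and> sorted (b # take j xs)
            then (1 - t) ^ Suc j * word_weight t (drop j xs) else 0)
      = (if a \<le> b then (1 - t) * t ^ word_des (b # xs) else 0)"
    unfolding Cons.IH by (auto simp: sum_distrib_left mult.assoc intro!: sum.cong)
  \<comment> \<open>At an ascent \<open>t + (1 - t) = 1\<close>; at a descent only the factor
    \<open>t\<close> is present.\<close>
  also have "word_weight t (b # xs) + \<dots> = t ^ word_des (a # b # xs)"
    by (auto simp: word_weight_def algebra_simps)
  finally show ?case ..
qed

text \<open>An increasing prefix of distinct letters is determined by its set \<open>U\<close>.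
  Marking such a prefix in a word therefore amounts to choosing \<open>U\<close> among the letters
  not below \<open>a\<close> and arranging the remaining letters; the prefix length \<open>j\<close>
  becomes \<open>card U\<close>.\<close>

lemma sum_permutations_sorted_prefix:
  fixes V :: "'b::linorder set"
  assumes "finite V"
  shows "(\<Sum>xs\<in>permutations_of_set V. \<Sum>j\<le>length xs.
      if sorted (a # take j xs) then h j (drop j xs) else 0)
    = (\<Sum>U\<in>Pow {v\<in>V. a \<le> v}. \<Sum>ys\<in>permutations_of_set (V - U). h (card U) ys)"
    (is "?L = ?R")
proof -
  have "?L = (\<Sum>xs\<in>permutations_of_set V. \<Sum>j\<in>{j. j \<le> length xs \<and> sorted (a # take j xs)}.
      h j (drop j xs))"
    by (intro sum.cong refl sum.mono_neutral_cong_right) auto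
  also have "\<dots> = (\<Sum>(xs, j)\<in>Sigma (permutations_of_set V)
      (\<lambda>xs. {j. j \<le> length xs \<and> sorted (a # take j xs)}). h j (drop j xs))"
    by (rule sum.Sigma) auto
  also have "\<dots> = (\<Sum>(U, ys)\<in>Sigma (Pow {v\<in>V. a \<le> v}) (\<lambda>U. permutations_of_set (V - U)).
      h (card U) ys)"
  \<comment> \<open>The inverse map writes \<open>U\<close> in increasing order in front of
    \<open>ys\<close> and cuts after \<open>card U\<close> letters.\<close>
  proof (rule sum.reindex_bij_witness[where
        i = "\<lambda>(U, ys). (sorted_list_of_set U @ ys, card U)" and
        j = "\<lambda>(xs, j). (set (take j xs), drop j xs)"], goal_cases)
    case (1 z)
    then show ?case
      by (auto simp: permutations_of_set_def distinct_card min_def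
          sorted_list_of_set.idem_if_sorted_distinct)
  next
    case (2 z)
    then obtain xs j where z: "z = (xs, j)" "set xs = V" "distinct xs" "j \<le> length xs"
        "sorted (a # take j xs)"
      by (auto simp: permutations_of_set_def)
    have "set (take j xs) \<union> set (drop j xs) = V" "set (take j xs) \<inter> set (drop j xs) = {}"
      using z by (metis append_take_drop_id set_append, metis append_take_drop_id distinct_append)
    then show ?case
      using z by (auto simp: permutations_of_set_def)
  next
    case (3 z)
    then obtain U ys where z: "z = (U, ys)" "U \<subseteq> V"
      by auto
    then have "finite U"
      using assms finite_subset by blast
    with z show ?case by simp
  next
    case (4 z)
    then obtain U ys where z: "z = (U, ys)" "U \<subseteq> V" "\<forall>u\<in>U. a \<le> u"
        "set ys = V - U" "distinct ys"
      by (auto simp: permutations_of_set_def)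
    then have "finite U"
      using assms finite_subset by blast
    with z show ?case by (auto simp: permutations_of_set_def)
  next
    case (5 z)
    then show ?case
      by (auto simp: permutations_of_set_def distinct_card min_def)
  qed
  also have "\<dots> = ?R"
    using assms by (intro sum.Sigma[symmetric]) (auto intro: finite_subset)
  finally show ?thesis .
qed

section \<open>Signed permutations as words\<close>

text \<open>One-line notation of signed permutations. Distinctness is imposed on absolute values, so
  that no letter occurs together with its negative.\<close>

definition signed_words :: "nat \<Rightarrow> int list set" where
  "signed_words n = {xs. distinct (map abs xs) \<and> abs ` set xs = {1..int n}}"

lemma length_signed_words: "xs \<in> signed_words n \<Longrightarrow> length xs = n"
  using distinct_card[of "map abs xs"] by (simp add: signed_words_def)

lemma signed_perms_zero:
  assumes "p \<in> signed_perms n"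
  shows "p 0 = 0"
proof -
  have "p (- 0) = - p 0"
    using assms unfolding signed_perms_def by force
  then show ?thesis
    by simp
qed

text \<open>Oddness recovers a signed permutation from its values at positive positions: it fixes 0
  and determines the negative half.\<close>

lemma map_bij_signed_perms:
  "bij_betw (\<lambda>p. map (\<lambda>i. p (int i)) [1..<Suc n]) (signed_perms n) (signed_words n)"
proof (rule bij_betw_imageI)
  show "inj_on (\<lambda>p. map (\<lambda>i. p (int i)) [1..<Suc n]) (signed_perms n)"
  proof (rule inj_onI, rule ext)
    fix p q :: "int \<Rightarrow> int" and i
    assume p: "p \<in> signed_perms n" and q: "q \<in> signed_perms n"
      and eq: "map (\<lambda>i. p (int i)) [1..<Suc n] = map (\<lambda>i. q (int i)) [1..<Suc n]"
    have pos: "p k = q k" if "k \<in> {1..int n}" for k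
    proof -
      have "nat k \<in> set [1..<Suc n]"
        using that by auto
      then have "p (int (nat k)) = q (int (nat k))"
        using eq unfolding map_eq_conv by blast
      then show ?thesis
        using that by simp
    qed
    have ngp: "r k = - r (- k)" if "r \<in> signed_perms n" "- k \<in> {1..int n}" for r k
    proof -
      have "k \<in> {- int n..int n}"
        using that by auto
      then have "r (- k) = - r k"
        using that unfolding signed_perms_def by blast
      then show ?thesis by simp
    qed
    consider "i \<in> {1..int n}" | "i = 0" | "- i \<in> {1..int n}" | "i \<notin> {- int n..int n}"
      unfolding atLeastAtMost_iff by linarith
    then show "p i = q i"
    proof cases
      case 1 then show ?thesis by (rule pos)
    next
      case 2 then show ?thesis using p q by (simp add: signed_perms_zero)
    next
      case 3 then show ?thesis using ngp[OF p 3] ngp[OF q 3] pos[OF 3] by simp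
    next
      case 4 then show ?thesis
        using p q unfolding signed_perms_def by (auto simp: permutes_not_in)
    qed
  qed
  show "(\<lambda>p. map (\<lambda>i. p (int i)) [1..<Suc n]) ` signed_perms n = signed_words n"
  proof (intro equalityI subsetI)
    fix xs assume "xs \<in> (\<lambda>p. map (\<lambda>i. p (int i)) [1..<Suc n]) ` signed_perms n"
    then obtain p where p: "p permutes {- int n..int n}"
      and odd: "\<And>i. i \<in> {- int n..int n} \<Longrightarrow> p (- i) = - p i"
      and xs: "xs = map (\<lambda>i. p (int i)) [1..<Suc n]"
      by (auto simp: signed_perms_def)
    have p0: "p 0 = 0"
      using odd[of 0] by simp
    have inj: "inj p"
      using p by (rule permutes_inj)
    \<comment> \<open>Equal absolute values mean \<open>p i = p j\<close> or
      \<open>p i = p (- j)\<close>; as \<open>p\<close> is injective, \<open>i = j\<close> or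
      \<open>i = - j\<close>, and the latter is impossible for positive indices.\<close>
    have injabs: "inj_on (\<lambda>i. \<bar>p (int i)\<bar>) {1..n}"
    proof (rule inj_onI)
      fix i j assume ij: "i \<in> {1..n}" "j \<in> {1..n}" and "\<bar>p (int i)\<bar> = \<bar>p (int j)\<bar>"
      then have "p (int i) = p (int j) \<or> p (int i) = p (- int j)"
        using odd[of "int j"] by (auto simp: abs_eq_iff)
      then show "i = j"
        using inj ij by (auto simp: inj_eq)
    qed
    moreover have "(\<lambda>i. \<bar>p (int i)\<bar>) ` {1..n} \<subseteq> {1..int n}"
    proof
      fix v assume "v \<in> (\<lambda>i. \<bar>p (int i)\<bar>) ` {1..n}"
      then obtain i where i: "i \<in> {1..n}" "v = \<bar>p (int i)\<bar>"
        by auto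
      have "p (int i) \<in> {- int n..int n}"
        using permutes_in_image[OF p, of "int i"] i by auto
      moreover have "p (int i) \<noteq> p 0"
        using injD[OF inj, of "int i" 0] i by auto
      ultimately show "v \<in> {1..int n}"
        using i p0 by auto
    qed
    ultimately have "(\<lambda>i. \<bar>p (int i)\<bar>) ` {1..n} = {1..int n}"
      by (intro card_subset_eq) (auto simp: card_image)
    moreover have "set [1..<Suc n] = {1..n}"
      by auto
    ultimately show "xs \<in> signed_words n"
      using injabs unfolding xs signed_words_def mem_Collect_eq map_map o_def
      unfolding distinct_map set_map image_image by (simp del: upt_Suc)
  next
    fix xs assume xs: "xs \<in> signed_words n"
    then have set: "abs ` set xs = {1..int n}" and dist: "distinct (map abs xs)"
      by (auto simp: signed_words_def)
    have len: "length xs = n"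
      using xs by (rule length_signed_words)
    \<comment> \<open>The odd extension of the word; 0 and everything outside the range fall into
      the last branch and stay fixed.\<close>
    define p where "p i = (if i \<in> {1..int n} then xs ! (nat i - 1)
      else if - i \<in> {1..int n} then - xs ! (nat (- i) - 1) else i)" for i
    have odd: "p (- i) = - p i" for i
      by (auto simp: p_def)
    have p0: "p 0 = 0"
      by (simp add: p_def)
    have mem: "\<bar>p i\<bar> \<in> {1..int n}" if "i \<in> {1..int n}" for i
    proof -
      have "xs ! (nat i - 1) \<in> set xs"
        using that len by auto
      then have "\<bar>xs ! (nat i - 1)\<bar> \<in> {1..int n}"
        using set by blast
      then show ?thesis
        using that by (simp add: p_def)
    qed
    have inj_pos: "i = j" if "i \<in> {1..int n}" "j \<in> {1..int n}" "\<bar>p i\<bar> = \<bar>p j\<bar>" for i j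
    proof -
      have "map abs xs ! (nat i - 1) = map abs xs ! (nat j - 1)"
        using that len by (auto simp: p_def)
      then have "nat i - 1 = nat j - 1"
        using that len dist by (subst (asm) nth_eq_iff_index_eq) auto
      then show ?thesis
        using that by auto
    qed
    have abs_p: "\<bar>p i\<bar> = \<bar>p \<bar>i\<bar>\<bar>" for i
      using odd[of i] by (cases "i \<ge> 0") auto
    \<comment> \<open>The absolute value of \<open>p i\<close> depends only on that of
      \<open>i\<close>, so by \<open>inj_pos\<close> equal values at nonzero indices force the
      indices to agree up to sign. Opposite indices are excluded, since \<open>p j = - p j\<close>
      would give \<open>p j = 0\<close>.\<close>
    have "inj_on p {- int n..int n}"
    proof (rule inj_onI)
      fix i j assume ij: "i \<in> {- int n..int n}" "j \<in> {- int n..int n}" and eq: "p i = p j"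
      then have eqa: "\<bar>p \<bar>i\<bar>\<bar> = \<bar>p \<bar>j\<bar>\<bar>"
        using abs_p by metis
      have z: "k = 0 \<longleftrightarrow> p \<bar>k\<bar> = 0" if "k \<in> {- int n..int n}" for k
        using mem[of "\<bar>k\<bar>"] that p0 by fastforce
      have "i = 0 \<longleftrightarrow> j = 0"
        using z[OF ij(1)] z[OF ij(2)] eqa by (metis abs_eq_0)
      then show "i = j"
      proof (cases "i = 0 \<or> j = 0")
        case True
        with \<open>i = 0 \<longleftrightarrow> j = 0\<close> show ?thesis by simp
      next
        case False
        then have "\<bar>i\<bar> \<in> {1..int n}" "\<bar>j\<bar> \<in> {1..int n}"
          using ij by auto
        then have "\<bar>i\<bar> = \<bar>j\<bar>"
          using eqa by (rule inj_pos)
        moreover have "i \<noteq> - j"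
        proof
          assume "i = - j"
          then have "p j = 0"
            using eq odd[of j] by simp
          then show False
            using abs_p[of j] z[OF ij(2)] False by simp
        qed
        ultimately show ?thesis by (auto simp: abs_eq_iff)
      qed
    qed
    moreover have "p ` {- int n..int n} \<subseteq> {- int n..int n}"
    proof
      fix v assume "v \<in> p ` {- int n..int n}"
      then obtain i where i: "i \<in> {- int n..int n}" "v = p i"
        by auto
      show "v \<in> {- int n..int n}"
      proof (cases "i = 0")
        case False
        then have "\<bar>p \<bar>i\<bar>\<bar> \<in> {1..int n}"
          using i by (intro mem) auto
        then show ?thesis
          using i abs_p[of i] by auto
      qed (use i p0 in auto)
    qed
    ultimately have "bij_betw p {- int n..int n} {- int n..int n}"
      by (simp add: bij_betw_def endo_inj_surj)
    then have "p permutes {- int n..int n}"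
      by (rule bij_imp_permutes) (auto simp: p_def)
    moreover have "map (\<lambda>i. p (int i)) [1..<Suc n] = xs"
      using len by (intro nth_equalityI) (auto simp: p_def nat_add_distrib simp del: upt_Suc)
    ultimately show "xs \<in> (\<lambda>p. map (\<lambda>i. p (int i)) [1..<Suc n]) ` signed_perms n"
      using odd by (auto simp: signed_perms_def simp del: upt_Suc)
  qed
qed

text \<open>The leading 0 is the value \<open>p 0\<close>, so the comparison at position 0 becomes
  the first comparison of the word.\<close>

lemma des_B_eq_word_des:
  assumes "p \<in> signed_perms n"
  shows "des_B n p = word_des (0 # map (\<lambda>i. p (int i)) [1..<Suc n])"
proof -
  have "p 0 = 0"
    using assms by (rule signed_perms_zero)
  then have "0 # map (\<lambda>i. p (int i)) [1..<Suc n] = map (\<lambda>i. p (int i)) [0..<Suc n]"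
    by (simp add: upt_conv_Cons del: upt_Suc)
  moreover have "{i \<in> {0..<int n}. p i > p (i + 1)}
      = int ` {i \<in> {0..<n}. p (int i) > p (int (Suc i))}"
    (is "?L = ?R")
  proof (intro equalityI subsetI)
    fix i assume "i \<in> ?L"
    then show "i \<in> ?R"
      by (intro image_eqI[of _ _ "nat i"]) (auto simp: add.commute)
  qed (auto simp: add.commute)
  ultimately show ?thesis
    unfolding des_B_def by (simp add: word_des_map_upt card_image del: upt_Suc)
qed

lemma neg_eq_length_filter:
  "neg n p = length (filter (\<lambda>x. x < 0) (map (\<lambda>i. p (int i)) [1..<Suc n]))"
proof -
  have "{i \<in> {1..int n}. p i < 0} = int ` {i \<in> {1..n}. p (int i) < 0}"
    (is "?L = ?R")
  proof (intro equalityI subsetI)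
    fix i assume "i \<in> ?L"
    then show "i \<in> ?R"
      by (intro image_eqI[of _ _ "nat i"]) auto
  qed auto
  then have "neg n p = card {i \<in> {1..n}. p (int i) < 0}"
    by (simp add: neg_def card_image)
  also have "{i \<in> {1..n}. p (int i) < 0} = set (filter (\<lambda>i. p (int i) < 0) [1..<Suc n])"
    by auto
  also have "card \<dots> = length (filter (\<lambda>i. p (int i) < 0) [1..<Suc n])"
    by (rule distinct_card) (simp del: upt_Suc)
  finally show ?thesis
    by (simp add: filter_map o_def del: upt_Suc)
qed

lemma eulerian_poly_B_eq_sum_words:
  "eulerian_poly_B n y t
    = (\<Sum>xs\<in>signed_words n. y ^ length (filter (\<lambda>x. x < 0) xs) * t ^ word_des (0 # xs))"
proof (cases "n = 0")
  case True
  then have "signed_words n = {[]}"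
    by (auto simp: signed_words_def)
  with True show ?thesis
    by (simp add: eulerian_poly_B_def)
next
  case False
  then have "eulerian_poly_B n y t
      = (\<Sum>p\<in>signed_perms n.
          y ^ length (filter (\<lambda>x. x < 0) (map (\<lambda>i. p (int i)) [1..<Suc n]))
          * t ^ word_des (0 # map (\<lambda>i. p (int i)) [1..<Suc n]))"
    unfolding eulerian_poly_B_def
    by (simp add: des_B_eq_word_des neg_eq_length_filter del: upt_Suc cong: sum.cong)
  also have "\<dots> = (\<Sum>xs\<in>signed_words n.
      y ^ length (filter (\<lambda>x. x < 0) xs) * t ^ word_des (0 # xs))"
    by (rule sum.reindex_bij_betw[OF map_bij_signed_perms])
  finally show ?thesis .
qed

section \<open>Signed words grouped by their negative letters\<close>

text \<open>The set \<open>T\<close> of absolute values of the negative letters fixes the letter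
  set, and the signed words with this \<open>T\<close> are exactly its arrangements. This separates
  the choice of signs from the order of the letters.\<close>

lemma sum_signed_words:
  "(\<Sum>xs\<in>signed_words n. g (length (filter (\<lambda>x. x < 0) xs)) xs)
    = (\<Sum>T\<in>Pow {1..int n}.
        \<Sum>xs\<in>permutations_of_set (uminus ` T \<union> ({1..int n} - T)). g (card T) xs)"
proof -
  let ?V = "\<lambda>T. uminus ` T \<union> ({1..int n} - T)"
  let ?T = "\<lambda>xs. {a \<in> {1..int n}. - a \<in> set xs}"
  have fin: "finite T" if "T \<subseteq> {1..int n}" for T
    using that by (rule finite_subset) simp
  have neg: "length (filter (\<lambda>x. x < 0) xs) = card T"
    if "T \<subseteq> {1..int n}" "xs \<in> permutations_of_set (?V T)" for T xs
  proof -
    have "length (filter (\<lambda>x. x < 0) xs) = card (set (filter (\<lambda>x. x < 0) xs))"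
      using that by (intro distinct_card[symmetric]) (auto simp: permutations_of_setD)
    also have "set (filter (\<lambda>x. x < 0) xs) = uminus ` T"
      using that by (force simp: permutations_of_setD)
    also have "card \<dots> = card T"
      by (simp add: card_image)
    finally show ?thesis .
  qed
  \<comment> \<open>Each element of \<open>{1..int n}\<close> occurs in \<open>xs\<close> with
    exactly one sign, because \<open>abs\<close> is injective on the letters; so the signs read off
    by \<open>?T xs\<close> rebuild the letter set.\<close>
  have V: "?V (?T xs) = set xs" if "xs \<in> signed_words n" for xs
  proof -
    have dist: "distinct (map abs xs)" and set: "abs ` set xs = {1..int n}"
      using that by (auto simp: signed_words_def)
    have inj: "inj_on abs (set xs)"
      using dist by (simp add: distinct_map)
    show ?thesis
    proof (intro equalityI subsetI)
      fix v assume v: "v \<in> set xs"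
      then have "\<bar>v\<bar> \<in> {1..int n}"
        using set by blast
      moreover have "- v \<notin> set xs" if "v > 0"
        using inj_onD[OF inj, of v "- v"] v that by auto
      ultimately show "v \<in> ?V (?T xs)"
        using v by (cases "v > 0") (auto intro: image_eqI[of _ _ "- v"])
    next
      fix v assume v: "v \<in> ?V (?T xs)"
      show "v \<in> set xs"
      proof (cases "v \<in> uminus ` ?T xs")
        case False
        then have *: "v \<in> {1..int n}" "- v \<notin> set xs"
          using v by auto
        then obtain w where "w \<in> set xs" "\<bar>w\<bar> = v"
          using set by (metis imageE)
        then show ?thesis
          using * by (cases "w \<ge> 0") auto
      qed auto
    qed
  qed
  have W: "xs \<in> signed_words n" "?T xs = T"
    if "T \<subseteq> {1..int n}" "xs \<in> permutations_of_set (?V T)" for T xs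
  proof -
    have xs: "set xs = ?V T" "distinct xs"
      using that by (auto simp: permutations_of_setD)
    \<comment> \<open>Negated letters have absolute values in \<open>T\<close>, the others outside
      \<open>T\<close>, so no absolute value is repeated.\<close>
    have "inj_on abs (?V T)"
      using that(1) by (auto simp: inj_on_def abs_if)
    moreover have "abs ` ?V T = {1..int n}"
    proof -
      have "abs ` T = T" "abs ` ({1..int n} - T) = {1..int n} - T"
        using that(1) by (auto simp: subset_eq image_def intro!: bexI abs_of_nonneg[symmetric])
      then show ?thesis
        using that(1) by (auto simp: image_Un image_image)
    qed
    ultimately show "xs \<in> signed_words n"
      using xs by (simp add: signed_words_def distinct_map)
    show "?T xs = T"
      using xs that(1) by auto
  qed
  have "(\<Sum>xs\<in>signed_words n. g (length (filter (\<lambda>x. x < 0) xs)) xs)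
      = (\<Sum>(T, xs)\<in>Sigma (Pow {1..int n}) (\<lambda>T. permutations_of_set (?V T)). g (card T) xs)"
  proof (rule sum.reindex_bij_witness[where i = snd and j = "\<lambda>xs. (?T xs, xs)"], goal_cases)
    case (1 xs)
    show ?case by simp
  next
    case (2 xs)
    have "distinct xs"
      using 2 by (auto simp: signed_words_def distinct_map)
    then show ?case
      using V[OF 2] by (auto simp: permutations_of_set_def)
  next
    case (3 z)
    then show ?case using W(2)[of "fst z" "snd z"] by (cases z) simp
  next
    case (4 z)
    then show ?case using W(1)[of "fst z" "snd z"] by (cases z) simp
  next
    case (5 xs)
    have "distinct xs"
      using 5 by (auto simp: signed_words_def distinct_map)
    then have "length (filter (\<lambda>x. x < 0) xs) = card (?T xs)"
      using V[OF 5] by (intro neg) (auto simp: permutations_of_set_def)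
    then show ?case
      by simp
  qed
  also have "\<dots> = (\<Sum>T\<in>Pow {1..int n}. \<Sum>xs\<in>permutations_of_set (?V T). g (card T) xs)"
    by (intro sum.Sigma[symmetric]) (auto intro: fin)
  finally show ?thesis .
qed

section \<open>Sums over subsets and the final computation\<close>

text \<open>Expand the product of the factors \<open>y + 1\<close> over \<open>S\<close>:
  \<open>T\<close> is the set of factors from which \<open>y\<close> is taken.\<close>

lemma sum_Pow_power_card:
  fixes y :: "'a::comm_semiring_1"
  assumes "finite S"
  shows "(\<Sum>T\<in>Pow S. y ^ card T) = (1 + y) ^ card S"
  using prod_add[OF assms, of "\<lambda>_. y" "\<lambda>_. 1"] by (simp add: add.commute)

lemma sum_Pow_card:
  fixes h :: "nat \<Rightarrow> 'a::comm_semiring_1"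
  assumes "finite S"
  shows "(\<Sum>U\<in>Pow S. h (card U)) = (\<Sum>k=0..card S. of_nat (card S choose k) * h k)"
proof -
  have "(\<Sum>U\<in>Pow S. h (card U))
      = (\<Sum>k=0..card S. \<Sum>U\<in>{U \<in> Pow S. card U = k}. h (card U))"
    using assms by (intro sum.group[symmetric]) (auto intro: card_mono)
  also have "\<dots> = (\<Sum>k=0..card S. of_nat (card S choose k) * h k)"
    using assms by (intro sum.cong refl) (simp add: n_subsets)
  finally show ?thesis .
qed

theorem theorem2p6:
  fixes n :: nat and y t :: "'a::comm_ring_1"
  shows "eulerian_poly_B n y t =
    (\<Sum>k=0..n. of_nat (n choose k) * (1 + y) ^ k * (1 - t) ^ (n - k) * eulerian_poly k t)"
proof -
  let ?S = "{1..int n}"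
  let ?V = "\<lambda>T. uminus ` T \<union> (?S - T)"
  have inner: "(\<Sum>xs\<in>permutations_of_set (?V T). t ^ word_des (0 # xs))
      = (\<Sum>U\<in>Pow (?S - T). (1 - t) ^ card U * eulerian_poly (n - card U) t)"
    if "T \<in> Pow ?S" for T
  proof -
    have fin: "finite T"
      using that by (auto intro: finite_subset)
    \<comment> \<open>Prefix letters must not be below the initial letter 0; as 0 is not in the
      letter set, they are exactly the letters left positive.\<close>
    have pos: "{v \<in> ?V T. 0 \<le> v} = ?S - T"
      using that by auto
    have "card (?V T) = card (uminus ` T) + card (?S - T)"
      using that fin by (intro card_Un_disjoint) auto
    also have "\<dots> = n"
      using that fin card_mono[of ?S T] by (simp add: card_image card_Diff_subset)
    finally have card: "card (?V T - U) = n - card U" if "U \<in> Pow (?S - T)" for U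
      using that by (subst card_Diff_subset) (auto intro: finite_subset)
    \<comment> \<open>The expansion is used with \<open>a = 0\<close>, then the prefix lemma with
      \<open>h j ys = (1 - t) ^ j * word_weight t ys\<close>.\<close>
    have "(\<Sum>xs\<in>permutations_of_set (?V T). t ^ word_des (0 # xs))
        = (\<Sum>U\<in>Pow (?S - T). \<Sum>ys\<in>permutations_of_set (?V T - U).
            (1 - t) ^ card U * word_weight t ys)"
      unfolding power_word_des_expand
      using fin by (subst sum_permutations_sorted_prefix)
        (simp_all only: pos finite_Un finite_imageI finite_Diff finite_atLeastAtMost_int)
    also have "\<dots> = (\<Sum>U\<in>Pow (?S - T). (1 - t) ^ card U * eulerian_poly (n - card U) t)"
    proof (rule sum.cong[OF refl])
      fix U assume "U \<in> Pow (?S - T)"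
      \<comment> \<open>Standardizing the \<open>n - card U\<close> remaining letters turns the sum
        over their arrangements into an Eulerian polynomial, whatever their signs.\<close>
      then show "(\<Sum>ys\<in>permutations_of_set (?V T - U). (1 - t) ^ card U * word_weight t ys)
          = (1 - t) ^ card U * eulerian_poly (n - card U) t"
        unfolding sum_distrib_left[symmetric] eulerian_poly_eq_sum_words
        using fin card by (subst sum_word_weight_permutations) simp_all
    qed
    finally show ?thesis .
  qed
  have "eulerian_poly_B n y t
      = (\<Sum>T\<in>Pow ?S. y ^ card T *
          (\<Sum>xs\<in>permutations_of_set (?V T). t ^ word_des (0 # xs)))"
    unfolding eulerian_poly_B_eq_sum_words sum_distrib_left
    by (rule sum_signed_words)
  also have "\<dots> = (\<Sum>T\<in>Pow ?S. \<Sum>U\<in>Pow (?S - T).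
      y ^ card T * ((1 - t) ^ card U * eulerian_poly (n - card U) t))"
    using inner by (simp add: sum_distrib_left)
  \<comment> \<open>Both sums run over the pairs of disjoint subsets \<open>T\<close> and
    \<open>U\<close> of \<open>?S\<close>, so the prefix may be chosen before the signs.\<close>
  also have "\<dots> = (\<Sum>U\<in>Pow ?S. \<Sum>T\<in>Pow (?S - U).
      y ^ card T * ((1 - t) ^ card U * eulerian_poly (n - card U) t))"
    by (subst (1 2) sum.Sigma)
       (auto intro: finite_subset intro!: sum.reindex_bij_witness[where i = prod.swap and j = prod.swap])
  \<comment> \<open>With the positive prefix letters \<open>U\<close> fixed, the signs of the other
    \<open>n - card U\<close> letters are free.\<close>
  also have "\<dots> = (\<Sum>U\<in>Pow ?S.
      (1 + y) ^ (n - card U) * ((1 - t) ^ card U * eulerian_poly (n - card U) t))"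
  proof (rule sum.cong[OF refl])
    fix U assume U: "U \<in> Pow ?S"
    then have "card (?S - U) = n - card U"
      by (subst card_Diff_subset) (auto intro: finite_subset)
    then show "(\<Sum>T\<in>Pow (?S - U).
        y ^ card T * ((1 - t) ^ card U * eulerian_poly (n - card U) t))
      = (1 + y) ^ (n - card U) * ((1 - t) ^ card U * eulerian_poly (n - card U) t)"
      by (simp add: sum_distrib_right[symmetric] sum_Pow_power_card)
  qed
  also have "\<dots> = (\<Sum>k=0..n. of_nat (n choose k)
      * ((1 + y) ^ (n - k) * ((1 - t) ^ k * eulerian_poly (n - k) t)))"
    using sum_Pow_card[of ?S "\<lambda>k. (1 + y) ^ (n - k) * ((1 - t) ^ k * eulerian_poly (n - k) t)"]
    by simp
  \<comment> \<open>The index is reversed: \<open>k\<close> counted the prefix letters and now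
    counts the letters after the prefix.\<close>
  also have "\<dots> = (\<Sum>k=0..n. of_nat (n choose k)
      * (1 + y) ^ k * (1 - t) ^ (n - k) * eulerian_poly k t)"
    by (subst sum.atLeastAtMost_rev)
       (auto intro!: sum.cong simp: binomial_symmetric[symmetric] mult.assoc)
  finally show ?thesis .
qed

end
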